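(* Let $s>1$ be an integer. Let $\Phi=(\phi_j)_{j=1}^n$ be an $(a,b,c)$-equiangular tight frame for a $d$-dimensional non-isotropic space $V$ over $\mathbb{F}$, with $d<n$, and suppose $\operatorname{Char}\mathbb{F}$ does not divide $s(s+1)$. Let $\kappa\subseteq[n]$ with $|\kappa|=s+1$. Then $(\phi_j)_{j\in\kappa}$ is a regular $s$-simplex if and only if $a^2=s^2b$, $\Delta(\phi_j,\phi_k,\phi_\ell)=-\frac{a^3}{s^3}\neq0$ for all distinct $j,k,\ell\in\kappa$, and, for some fixed $\ell\in\kappa$, $\sum_{j\in\kappa}\Delta(\phi_\ell,\phi_k,\phi_j)=\frac{s+1}{s}ab$ for all $k\in[n]\setminus\kappa$.
   Context: $\mathbb{F}$ is a finite field of one of two kinds: (Case U) $\mathbb{F}=\mathbb{F}_{q^2}$ with involution $x^\sigma=x^q$, or (Case O) $\mathbb{F}=\mathbb{F}_q$ with $x^\sigma=x$; in both cases $q$ is odd. A non-isotropic space is a finite-dimensional $\mathbb{F}$-vector space with a non-degenerate Hermitian scalar product $\langle\cdot,\cdot\rangle$ (linear in the second argument, $\langle u,v\rangle=\langle v,u\rangle^\sigma$, non-degenerate); a subspace is non-isotropic if the restricted form is non-degenerate. A sequence $\Phi$ with synthesis operator $x\mapsto\sum_jx_j\phi_j$ and adjoint $\Phi^\dagger v=(\langle\phi_j,v\rangle)_j$ is a $c$-tight frame for a non-isotropic subspace $U$ if it spans $U$ and $\Phi\Phi^\dagger=cI$ on $U$; an $(a,b,c)$-equiangular tight frame for $U$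 if moreover $\langle\phi_j,\phi_j\rangle=a$ for all $j$ and $\langle\phi_j,\phi_k\rangle\langle\phi_k,\phi_j\rangle=b$ for $j\neq k$. $(\phi_j)_{j\in\kappa}$ ($|\kappa|=s+1$) is a regular $s$-simplex if it is an $(a,b,c')$-equiangular tight frame, for some $c'$, for its span, which is an $s$-dimensional non-isotropic subspace. $\Delta(\phi_j,\phi_k,\phi_\ell)=\langle\phi_j,\phi_k\rangle\langle\phi_k,\phi_\ell\rangle\langle\phi_\ell,\phi_j\rangle$. Integers and fractions are interpreted in $\mathbb{F}$. *)

theory Defs
  imports "HOL-Computational_Algebra.Computational_Algebra" "HOL-Library.Cardinality"
begin

text \<open>The disjuncts are case U (field of order \<open>q\<^sup>2\<close>) and case O (field of order \<open>q\<close>). Since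
  \<open>'f\<close> is a finite field, its cardinality forces \<open>q\<close> to be a prime power.\<close>

definition finite_field_involution :: "nat \<Rightarrow> ('f::{field,finite} \<Rightarrow> 'f) \<Rightarrow> bool" where
  "finite_field_involution q \<sigma> \<longleftrightarrow> odd q \<and>
     ((CARD('f) = q ^ 2 \<and> (\<forall>x. \<sigma> x = x ^ q)) \<or>
      (CARD('f) = q \<and> (\<forall>x. \<sigma> x = x)))"

definition nondegenerate_on :: "'v::ab_group_add set \<Rightarrow> ('v \<Rightarrow> 'v \<Rightarrow> 'f::field) \<Rightarrow> bool" where
  "nondegenerate_on U form \<longleftrightarrow> (\<forall>u\<in>U. (\<forall>v\<in>U. form u v = 0) \<longrightarrow> u = 0)"

locale nonisotropic_space = vector_space scale
  for scale :: "'f::{field,finite} \<Rightarrow> 'v::ab_group_add \<Rightarrow> 'v" (infixr \<open>*s\<close> 75) +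
  fixes q :: nat and \<sigma> :: "'f \<Rightarrow> 'f" and form :: "'v \<Rightarrow> 'v \<Rightarrow> 'f"
  assumes involution: "finite_field_involution q \<sigma>"
    and finite_dimensional: "\<exists>B. finite B \<and> span B = UNIV"
    and form_add_right: "form u (v + w) = form u v + form u w"
    and form_scale_right: "form u (r *s v) = r * form u v"
    and form_hermitian: "form u v = \<sigma> (form v u)"
    and nondegenerate: "nondegenerate_on UNIV form"

definition nonisotropic_subspace ::
  "('f::field \<Rightarrow> 'v::ab_group_add \<Rightarrow> 'v) \<Rightarrow> ('v \<Rightarrow> 'v \<Rightarrow> 'f) \<Rightarrow> 'v set \<Rightarrow> bool" where
  "nonisotropic_subspace scale form U \<longleftrightarrow> module.subspace scale U \<and> nondegenerate_on U form"

text \<open>A sequence is a function together with a finite index set \<open>J\<close>; coordinate vectors in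
  \<open>F\<^sup>J\<close> are functions of which only the values on \<open>J\<close> matter.\<close>

definition synthesis ::
  "('f::field \<Rightarrow> 'v::ab_group_add \<Rightarrow> 'v) \<Rightarrow> 'i set \<Rightarrow> ('i \<Rightarrow> 'v) \<Rightarrow> ('i \<Rightarrow> 'f) \<Rightarrow> 'v" where
  "synthesis scale J \<phi> x = (\<Sum>j\<in>J. scale (x j) (\<phi> j))"

definition analysis :: "('v \<Rightarrow> 'v \<Rightarrow> 'f) \<Rightarrow> ('i \<Rightarrow> 'v) \<Rightarrow> 'v \<Rightarrow> ('i \<Rightarrow> 'f)" where
  "analysis form \<phi> v = (\<lambda>j. form (\<phi> j) v)"

definition tight_frame ::
  "('f::field \<Rightarrow> 'v::ab_group_add \<Rightarrow> 'v) \<Rightarrow> ('v \<Rightarrow> 'v \<Rightarrow> 'f) \<Rightarrow> 'f \<Rightarrow> 'v set \<Rightarrow>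
     'i set \<Rightarrow> ('i \<Rightarrow> 'v) \<Rightarrow> bool" where
  "tight_frame scale form c U J \<phi> \<longleftrightarrow>
     nonisotropic_subspace scale form U \<and> finite J \<and> module.span scale (\<phi> ` J) = U \<and>
     (\<forall>v\<in>U. synthesis scale J \<phi> (analysis form \<phi> v) = scale c v)"

definition equiangular_tight_frame ::
  "('f::field \<Rightarrow> 'v::ab_group_add \<Rightarrow> 'v) \<Rightarrow> ('v \<Rightarrow> 'v \<Rightarrow> 'f) \<Rightarrow> 'f \<Rightarrow> 'f \<Rightarrow> 'f \<Rightarrow> 'v set \<Rightarrow>
     'i set \<Rightarrow> ('i \<Rightarrow> 'v) \<Rightarrow> bool" where
  "equiangular_tight_frame scale form a b c U J \<phi> \<longleftrightarrow>
     tight_frame scale form c U J \<phi> \<and>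
     (\<forall>j\<in>J. form (\<phi> j) (\<phi> j) = a) \<and>
     (\<forall>j\<in>J. \<forall>k\<in>J. j \<noteq> k \<longrightarrow> form (\<phi> j) (\<phi> k) * form (\<phi> k) (\<phi> j) = b)"

definition regular_simplex ::
  "('f::field \<Rightarrow> 'v::ab_group_add \<Rightarrow> 'v) \<Rightarrow> ('v \<Rightarrow> 'v \<Rightarrow> 'f) \<Rightarrow> 'f \<Rightarrow> 'f \<Rightarrow> nat \<Rightarrow>
     'i set \<Rightarrow> ('i \<Rightarrow> 'v) \<Rightarrow> bool" where
  "regular_simplex scale form a b s \<kappa> \<phi> \<longleftrightarrow>
     card \<kappa> = s + 1 \<and>
     nonisotropic_subspace scale form (module.span scale (\<phi> ` \<kappa>)) \<and>
     vector_space.dim scale (module.span scale (\<phi> ` \<kappa>)) = s \<and>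
     (\<exists>c'. equiangular_tight_frame scale form a b c' (module.span scale (\<phi> ` \<kappa>)) \<kappa> \<phi>)"

definition triple_product :: "('v \<Rightarrow> 'v \<Rightarrow> 'f::field) \<Rightarrow> 'v \<Rightarrow> 'v \<Rightarrow> 'v \<Rightarrow> 'f" where
  "triple_product form x y z = form x y * form y z * form z x"

end

theory Submission
  imports Defs
begin

text \<open>Fix \<open>l \<in> \<kappa>\<close> and put \<open>x\<^sub>l = 1\<close>, \<open>x\<^sub>j = -(s/a) \<langle>\<phi>\<^sub>j, \<phi>\<^sub>l\<rangle>\<close>. The conditions \<open>a\<^sup>2 = s\<^sup>2 b\<close> and
  \<open>\<Delta> = -a\<^sup>3/s\<^sup>3\<close> say that the Gram matrix of \<open>(\<phi>\<^sub>j)\<^bsub>j\<in>\<kappa>\<^esub>\<close>, conjugated by the diagonal matrix of \<open>x\<close>, is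
  \<open>(a/s) ((s+1) I - J)\<close> with \<open>J\<close> the all-ones matrix; hence \<open>w = \<Sum> x\<^sub>j \<phi>\<^sub>j\<close> is orthogonal to every
  \<open>\<phi>\<^sub>j\<close> with \<open>j \<in> \<kappa>\<close>. The sum condition says that \<open>w\<close> is orthogonal to the remaining \<open>\<phi>\<^sub>k\<close> as well, so
  altogether it amounts to \<open>w = 0\<close>, which makes \<open>(\<phi>\<^sub>j)\<^bsub>j\<in>\<kappa>\<^esub>\<close> a tight frame for an \<open>s\<close>-dimensional space.
  Conversely, for a regular simplex with frame constant \<open>c'\<close> and Gram matrix \<open>G\<close>, the columns of
  \<open>c' I - G\<close> lie in the kernel of the synthesis operator, which is a line; so \<open>c' I - G\<close> has rank at most
  one, and this determines \<open>G\<close> up to conjugation by a diagonal matrix.\<close>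

section \<open>Linear relations of finite indexed families\<close>

context vector_space
begin

text \<open>\<open>independent\<close> concerns sets and does not see repeated vectors, hence the
  injectivity. A repetition \<open>\<phi> i = \<phi> j\<close> is itself a relation, with
  coefficient 1 at \<open>i\<close> and -1 at \<open>j\<close>.\<close>

lemma independent_family_iff:
  assumes "finite K"
  shows "(inj_on \<phi> K \<and> independent (\<phi> ` K)) \<longleftrightarrow>
    (\<forall>y. (\<Sum>k\<in>K. y k *s \<phi> k) = 0 \<longrightarrow> (\<forall>k\<in>K. y k = 0))"
proof (intro iffI allI impI)
  fix y
  assume ind: "inj_on \<phi> K \<and> independent (\<phi> ` K)" and "(\<Sum>k\<in>K. y k *s \<phi> k) = 0"
  then have "(\<Sum>v\<in>\<phi> ` K. y (the_inv_into K \<phi> v) *s v) = 0"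
    by (simp add: sum.reindex the_inv_into_f_f)
  then have "y (the_inv_into K \<phi> (\<phi> k)) = 0" if "k \<in> K" for k
    using independentD[of "\<phi> ` K" "\<phi> ` K" "\<lambda>v. y (the_inv_into K \<phi> v)"] ind assms that by auto
  then show "\<forall>k\<in>K. y k = 0"
    using ind by (simp add: the_inv_into_f_f)
next
  assume zero: "\<forall>y. (\<Sum>k\<in>K. y k *s \<phi> k) = 0 \<longrightarrow> (\<forall>k\<in>K. y k = 0)"
  have inj: "inj_on \<phi> K"
  proof (rule inj_onI, rule ccontr)
    fix i j assume ij: "i \<in> K" "j \<in> K" "\<phi> i = \<phi> j" "i \<noteq> j"
    let ?y = "\<lambda>k. (if k = i then 1 else 0) - (if k = j then 1 else 0) :: 'a"
    have "(\<Sum>k\<in>K. ?y k *s \<phi> k) =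
        (\<Sum>k\<in>K. (if k = i then \<phi> k else 0)) - (\<Sum>k\<in>K. (if k = j then \<phi> k else 0))"
      unfolding sum_subtractf[symmetric] by (rule sum.cong) auto
    also have "\<dots> = 0"
      using ij assms by simp
    finally have "?y i = 0"
      using zero[rule_format, of ?y i] ij by blast
    then show False using ij by simp
  qed
  moreover have "independent (\<phi> ` K)"
  proof (rule independent_if_scalars_zero)
    fix f v assume "(\<Sum>v\<in>\<phi> ` K. f v *s v) = 0" "v \<in> \<phi> ` K"
    then show "f v = 0"
      using zero[rule_format, of "f \<circ> \<phi>"] inj by (auto simp: sum.reindex)
  qed (use assms in simp)
  ultimately show "inj_on \<phi> K \<and> independent (\<phi> ` K)" by simp
qed

text \<open>A basis chosen inside the family omits exactly one index \<open>m\<close>, and expanding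
  \<open>\<phi> m\<close> in that basis gives \<open>x\<close>. For any relation \<open>z\<close>,
  the relation \<open>z - z m * x\<close> vanishes at \<open>m\<close>, so it involves only the
  basis and is zero.\<close>

lemma one_dimensional_relations:
  assumes "finite K" and "card K = Suc (dim (span (\<phi> ` K)))"
  obtains m x where "m \<in> K" and "x m = 1" and "(\<Sum>k\<in>K. x k *s \<phi> k) = 0"
    and "\<And>z. (\<Sum>k\<in>K. z k *s \<phi> k) = 0 \<Longrightarrow> \<forall>k\<in>K. z k = z m * x k"
proof -
  obtain B where B: "B \<subseteq> \<phi> ` K" "independent B" "\<phi> ` K \<subseteq> span B" "card B = dim (\<phi> ` K)"
    using basis_exists by blast
  then obtain L where L: "L \<subseteq> K" "inj_on \<phi> L" "B = \<phi> ` L"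
    by (auto simp: subset_image_inj)
  have finL: "finite L" using L assms finite_subset by blast
  have "card L = dim (span (\<phi> ` K))"
    using B L card_image by (metis dim_span)
  then have "card (K - L) = 1"
    using assms L finL by (simp add: card_Diff_subset)
  then obtain m where m: "K - L = {m}" by (auto simp: card_1_singleton_iff)
  have K: "K = insert m L" "m \<notin> L" using m L by auto
  have "\<phi> m \<in> span (\<phi> ` L)" using B L K by auto
  then obtain u where "\<phi> m = (\<Sum>v\<in>\<phi> ` L. u v *s v)"
    using finL by (auto simp: span_finite)
  then have u: "\<phi> m = (\<Sum>k\<in>L. u (\<phi> k) *s \<phi> k)"
    using L by (simp add: sum.reindex)
  define x where "x k = (if k = m then 1 else - u (\<phi> k))" for k
  have "(\<Sum>k\<in>L. x k *s \<phi> k) = (\<Sum>k\<in>L. - (u (\<phi> k) *s \<phi> k))"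
    by (rule sum.cong) (use K in \<open>auto simp: x_def\<close>)
  then have x0: "(\<Sum>k\<in>K. x k *s \<phi> k) = 0"
    using u K finL by (simp add: sum_negf x_def)
  have ker: "\<forall>k\<in>K. z k = z m * x k" if z: "(\<Sum>k\<in>K. z k *s \<phi> k) = 0" for z
  proof -
    have "(\<Sum>k\<in>K. (z k - z m * x k) *s \<phi> k) = 0"
    proof -
      have "(\<Sum>k\<in>K. (z k - z m * x k) *s \<phi> k) = (\<Sum>k\<in>K. z k *s \<phi> k - z m *s (x k *s \<phi> k))"
        by (simp add: scale_left_diff_distrib)
      also have "\<dots> = (\<Sum>k\<in>K. z k *s \<phi> k) - z m *s (\<Sum>k\<in>K. x k *s \<phi> k)"
        by (simp only: sum_subtractf scale_sum_right)
      finally show ?thesis using z x0 by simp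
    qed
    then have "(\<Sum>k\<in>L. (z k - z m * x k) *s \<phi> k) = 0"
      using K finL by (simp add: x_def)
    moreover have "inj_on \<phi> L \<and> independent (\<phi> ` L)" using L B by simp
    ultimately have "\<forall>k\<in>L. z k - z m * x k = 0"
      unfolding independent_family_iff[OF finL] by (elim allE impE)
    then show ?thesis using K by (simp add: x_def)
  qed
  show thesis
    by (rule that[of m x]) (use K x0 ker in \<open>auto simp: x_def\<close>)
qed

end

section \<open>Orthogonality and frame identities on spans\<close>

context nonisotropic_space
begin

lemma form_eq_0_commute: "form u v = 0 \<longleftrightarrow> form v u = 0"
proof -
  \<comment> \<open>This excludes \<open>q = 0\<close>, for which \<open>x ^ q\<close> would be 1 at
    \<open>x = 0\<close>.\<close>
  have "odd q" using involution by (simp add: finite_field_involution_def)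
  then have "q > 0" by (cases q) auto
  then have "\<sigma> x = 0 \<longleftrightarrow> x = 0" for x
    using involution by (auto simp: finite_field_involution_def)
  then show ?thesis by (metis form_hermitian)
qed

lemma form_zero_right [simp]: "form u 0 = 0"
  using form_scale_right[of u 0 0] by simp

lemma form_sum_scale_right: "form u (\<Sum>k\<in>K. y k *s \<phi> k) = (\<Sum>k\<in>K. y k * form u (\<phi> k))"
  by (induction K rule: infinite_finite_induct) (simp_all add: form_add_right form_scale_right)

lemma form_span_right_eq_0:
  assumes "v \<in> span S" and "\<And>z. z \<in> S \<Longrightarrow> form u z = 0"
  shows "form u v = 0"
  using assms by (induction rule: span_induct_alt) (auto simp: form_add_right form_scale_right)

lemma nondegenerate_span_eq_0:
  assumes "nondegenerate_on (span S) form" "w \<in> span S" "\<And>z. z \<in> S \<Longrightarrow> form z w = 0"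
  shows "w = 0"
  using assms form_span_right_eq_0[of _ S w] form_eq_0_commute
  unfolding nondegenerate_on_def by metis

lemma tight_on_spanI:
  assumes "v \<in> span (\<phi> ` K)"
    and "\<And>k. k \<in> K \<Longrightarrow> (\<Sum>j\<in>K. form (\<phi> j) (\<phi> k) *s \<phi> j) = c *s \<phi> k"
  shows "(\<Sum>j\<in>K. form (\<phi> j) v *s \<phi> j) = c *s v"
  using assms(1)
proof (induction rule: span_induct_alt)
  case base
  show ?case by simp
next
  case (step r z v)
  then obtain k where k: "k \<in> K" "z = \<phi> k" by auto
  have "(\<Sum>j\<in>K. form (\<phi> j) (r *s z + v) *s \<phi> j)
      = r *s (\<Sum>j\<in>K. form (\<phi> j) z *s \<phi> j) + (\<Sum>j\<in>K. form (\<phi> j) v *s \<phi> j)"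
    by (simp add: form_add_right form_scale_right scale_left_distrib sum.distrib scale_sum_right)
  then show ?case
    using step k assms(2) by (simp add: scale_right_distrib mult.commute)
qed

section \<open>From a Gram matrix of simplex shape to a regular simplex\<close>

text \<open>The \<open>s\<close> off-diagonal terms contribute \<open>- r * x j\<close> each and
  cancel the diagonal term \<open>s * r * x j\<close>.\<close>

lemma simplex_vector_orthogonal:
  assumes "finite K" "card K = s + 1" "j \<in> K" "form (\<phi> j) (\<phi> j) = of_nat s * r"
    and "\<And>k. k \<in> K \<Longrightarrow> j \<noteq> k \<Longrightarrow> form (\<phi> j) (\<phi> k) * x k = - r * x j"
  shows "form (\<phi> j) (\<Sum>k\<in>K. x k *s \<phi> k) = 0"
proof -
  have "form (\<phi> j) (\<Sum>k\<in>K. x k *s \<phi> k) = x j * form (\<phi> j) (\<phi> j) + (\<Sum>k\<in>K - {j}. x k * form (\<phi> j) (\<phi> k))"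
    unfolding form_sum_scale_right using assms(1,3) by (rule sum.remove)
  also have "(\<Sum>k\<in>K - {j}. x k * form (\<phi> j) (\<phi> k)) = (\<Sum>k\<in>K - {j}. - r * x j)"
    by (rule sum.cong) (use assms in \<open>auto simp: mult.commute\<close>)
  also have "\<dots> = - (of_nat s * r * x j)"
    using assms by simp
  finally show ?thesis using assms by simp
qed

text \<open>Column \<open>k\<close> of the Gram matrix is \<open>(s + 1) * r\<close> times the unit
  vector at \<open>k\<close> plus a multiple of \<open>x\<close>, and synthesis kills
  \<open>x\<close>.\<close>

lemma simplex_frame_equation:
  assumes "finite K" "k \<in> K" "form (\<phi> k) (\<phi> k) = of_nat s * r" "x k \<noteq> 0"
    and off: "\<And>j. j \<in> K \<Longrightarrow> j \<noteq> k \<Longrightarrow> form (\<phi> j) (\<phi> k) * x k = - r * x j"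
    and w: "(\<Sum>j\<in>K. x j *s \<phi> j) = 0"
  shows "(\<Sum>j\<in>K. form (\<phi> j) (\<phi> k) *s \<phi> j) = (of_nat (s + 1) * r) *s \<phi> k"
proof -
  have "form (\<phi> j) (\<phi> k) = (if j = k then of_nat (s + 1) * r else 0) + (- r / x k) * x j" if "j \<in> K" for j
    using assms(3,4) off[OF that] by (auto simp: field_simps)
  then have "(\<Sum>j\<in>K. form (\<phi> j) (\<phi> k) *s \<phi> j) =
      (\<Sum>j\<in>K. (if j = k then (of_nat (s + 1) * r) *s \<phi> j else 0) + (- r / x k) *s (x j *s \<phi> j))"
    by (intro sum.cong) (auto simp: scale_left_distrib scale_left_diff_distrib)
  also have "\<dots> = (of_nat (s + 1) * r) *s \<phi> k + (- r / x k) *s (\<Sum>j\<in>K. x j *s \<phi> j)"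
    unfolding sum.distrib scale_sum_right using assms(1,2) by simp
  finally show ?thesis using w by simp
qed

text \<open>The Gram matrix is \<open>(s + 1) * r\<close> times the identity minus a rank-one
  matrix. The relation \<open>x\<close> puts \<open>\<phi> l\<close> in the span of the other
  \<open>s\<close> vectors, and these are independent.\<close>

lemma simplex_dim:
  assumes "finite K" "card K = s + 1" and l: "l \<in> K"
    and r: "of_nat (s + 1) * r \<noteq> 0"
    and diag: "\<And>j. j \<in> K \<Longrightarrow> form (\<phi> j) (\<phi> j) = of_nat s * r"
    and x: "\<And>j. j \<in> K \<Longrightarrow> x j \<noteq> 0"
    and off: "\<And>j k. j \<in> K \<Longrightarrow> k \<in> K \<Longrightarrow> j \<noteq> k \<Longrightarrow> form (\<phi> j) (\<phi> k) * x k = - r * x j"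
    and w: "(\<Sum>j\<in>K. x j *s \<phi> j) = 0"
  shows "dim (span (\<phi> ` K)) = s"
proof -
  let ?L = "K - {l}"
  have G: "form (\<phi> j) (\<phi> k) = (if j = k then of_nat (s + 1) * r else 0) - r * x j * (1 / x k)"
    if "j \<in> K" "k \<in> K" for j k
    using diag[OF that(1)] x[OF that(2)] off[OF that] by (auto simp: field_simps)
  have zero: "\<forall>k\<in>?L. y k = 0" if y: "(\<Sum>k\<in>?L. y k *s \<phi> k) = 0" for y
  proof -
    \<comment> \<open>The rank-one part acts on \<open>y\<close> through the scalar
      \<open>t\<close>. Pairing with \<open>\<phi> l\<close>, which is absent from the relation,
      gives \<open>t = 0\<close>; the other pairings then give \<open>y = 0\<close>.\<close>
    define t where "t = (\<Sum>k\<in>?L. y k * (1 / x k))"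
    have eq: "(if j = l then 0 else of_nat (s + 1) * r * y j) = r * x j * t" if j: "j \<in> K" for j
    proof -
      have "0 = form (\<phi> j) (\<Sum>k\<in>?L. y k *s \<phi> k)" using y by simp
      also have "\<dots> = (\<Sum>k\<in>?L. y k * form (\<phi> j) (\<phi> k))"
        by (rule form_sum_scale_right)
      also have "\<dots> = (\<Sum>k\<in>?L. (if j = k then of_nat (s + 1) * r * y k else 0) - r * x j * (y k * (1 / x k)))"
        by (rule sum.cong) (use j in \<open>auto simp: G algebra_simps\<close>)
      also have "\<dots> = (\<Sum>k\<in>?L. (if j = k then of_nat (s + 1) * r * y k else 0)) - r * x j * t"
        by (simp add: sum_subtractf sum_distrib_left t_def)
      also have "(\<Sum>k\<in>?L. (if j = k then of_nat (s + 1) * r * y k else 0)) = (if j = l then 0 else of_nat (s + 1) * r * y j)"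
        using j assms(1) by auto
      finally show ?thesis by simp
    qed
    have "t = 0" using eq[OF l] r x[OF l] by simp
    then show ?thesis using eq r by (metis DiffE insertI1 mult_eq_0_iff mult_zero_right)
  qed
  have ind: "inj_on \<phi> ?L" "independent (\<phi> ` ?L)"
    using independent_family_iff[of ?L \<phi>] zero assms(1) by blast+
  have "x l *s \<phi> l = - (\<Sum>k\<in>?L. x k *s \<phi> k)"
    using w l assms(1) by (simp add: sum.remove eq_neg_iff_add_eq_0)
  also have "\<dots> \<in> span (\<phi> ` ?L)"
    by (intro span_neg span_sum span_scale span_base) auto
  finally have "\<phi> l \<in> span (\<phi> ` ?L)"
    using x[OF l] span_scale[of "x l *s \<phi> l" "\<phi> ` ?L" "1 / x l"] by simp
  then have "span (insert (\<phi> l) (\<phi> ` ?L)) = span (\<phi> ` ?L)"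
    by (rule span_redundant)
  moreover have "insert (\<phi> l) (\<phi> ` ?L) = \<phi> ` K" using l by auto
  ultimately have "span (\<phi> ` ?L) = span (\<phi> ` K)" by simp
  then have "dim (\<phi> ` K) = card (\<phi> ` ?L)"
    using dim_eq_card ind by blast
  then show ?thesis using ind l assms(1,2) by (simp add: card_image)
qed

lemma regular_simplexI:
  assumes fin: "finite K" and card: "card K = s + 1" and l: "l \<in> K"
    and nz: "of_nat (s + 1) * r \<noteq> 0"
    and diag: "\<And>j. j \<in> K \<Longrightarrow> form (\<phi> j) (\<phi> j) = of_nat s * r"
    and x: "\<And>j. j \<in> K \<Longrightarrow> x j \<noteq> 0"
    and off: "\<And>j k. j \<in> K \<Longrightarrow> k \<in> K \<Longrightarrow> j \<noteq> k \<Longrightarrow> form (\<phi> j) (\<phi> k) * x k = - r * x j"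
    and w: "(\<Sum>j\<in>K. x j *s \<phi> j) = 0"
  shows "regular_simplex (*s) form (of_nat s * r) (r ^ 2) s K \<phi>"
proof -
  let ?U = "span (\<phi> ` K)"
  have tight: "(\<Sum>j\<in>K. form (\<phi> j) v *s \<phi> j) = (of_nat (s + 1) * r) *s v" if "v \<in> ?U" for v
    using tight_on_spanI[OF that] simplex_frame_equation[OF fin _ diag x off w] by simp
  \<comment> \<open>The frame operator kills a vector orthogonal to the span, yet it acts there as a
    nonzero scalar.\<close>
  have nondeg: "nondegenerate_on ?U form"
    unfolding nondegenerate_on_def
  proof (intro ballI impI)
    fix u assume u: "u \<in> ?U" "\<forall>v\<in>?U. form u v = 0"
    then have "\<forall>j\<in>K. form (\<phi> j) u = 0"
      using form_eq_0_commute span_base by blast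
    then have "(of_nat (s + 1) * r) *s u = 0"
      using tight[OF u(1)] by (simp add: sum.neutral)
    then show "u = 0" using nz by simp
  qed
  have nonis: "nonisotropic_subspace (*s) form ?U"
    using nondeg by (simp add: nonisotropic_subspace_def)
  have "form (\<phi> j) (\<phi> k) * form (\<phi> k) (\<phi> j) = r ^ 2" if "j \<in> K" "k \<in> K" "j \<noteq> k" for j k
  proof -
    have "form (\<phi> j) (\<phi> k) = - r * x j / x k" "form (\<phi> k) (\<phi> j) = - r * x k / x j"
      using off[OF that] off[OF that(2,1)] x that by (auto simp: field_simps)
    then show ?thesis using x that by (simp add: power2_eq_square)
  qed
  then have "equiangular_tight_frame (*s) form (of_nat s * r) (r ^ 2) (of_nat (s + 1) * r) ?U K \<phi>"
    using tight nonis fin diag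
    by (simp add: equiangular_tight_frame_def tight_frame_def synthesis_def analysis_def)
  then show ?thesis
    using nonis card simplex_dim[OF fin card l nz diag x off w]
    unfolding regular_simplex_def by blast
qed

section \<open>From a regular simplex to its Gram matrix\<close>

lemma regular_simplex_products:
  assumes simplex: "regular_simplex (*s) form a b s K \<phi>" and s: "s > 0" "of_nat s \<noteq> (0 :: 'f)"
  shows "a \<noteq> 0" and "a ^ 2 = of_nat s ^ 2 * b"
    and "\<And>j k l. j \<in> K \<Longrightarrow> k \<in> K \<Longrightarrow> l \<in> K \<Longrightarrow> j \<noteq> k \<Longrightarrow> k \<noteq> l \<Longrightarrow> j \<noteq> l \<Longrightarrow>
      triple_product form (\<phi> j) (\<phi> k) (\<phi> l) = - (a ^ 3 / of_nat s ^ 3)"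
proof -
  let ?U = "span (\<phi> ` K)"
  obtain c where card: "card K = s + 1" and nondeg: "nondegenerate_on ?U form" and dim: "dim ?U = s"
    and diag: "\<And>j. j \<in> K \<Longrightarrow> form (\<phi> j) (\<phi> j) = a"
    and off: "\<And>j k. j \<in> K \<Longrightarrow> k \<in> K \<Longrightarrow> j \<noteq> k \<Longrightarrow> form (\<phi> j) (\<phi> k) * form (\<phi> k) (\<phi> j) = b"
    and tight: "\<And>v. v \<in> ?U \<Longrightarrow> (\<Sum>j\<in>K. form (\<phi> j) v *s \<phi> j) = c *s v"
    using simplex unfolding regular_simplex_def nonisotropic_subspace_def equiangular_tight_frame_def
      tight_frame_def synthesis_def analysis_def by blast
  have fin: "finite K" using card by (metis add_is_0 card.infinite zero_neq_one)
  obtain m x where m: "m \<in> K" "x m = 1" and x0: "(\<Sum>k\<in>K. x k *s \<phi> k) = 0"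
    and ker: "\<And>z. (\<Sum>k\<in>K. z k *s \<phi> k) = 0 \<Longrightarrow> \<forall>k\<in>K. z k = z m * x k"
    using one_dimensional_relations[OF fin, of \<phi>] card dim by auto
  \<comment> \<open>Row \<open>m\<close> of \<open>c I - G\<close>. Since \<open>x m = 1\<close>,
    the relation in column \<open>k\<close> is \<open>t k\<close> times \<open>x\<close>.\<close>
  define t where "t k = (if m = k then c else 0) - form (\<phi> m) (\<phi> k)" for k
  have rank1: "(if j = k then c else 0) - form (\<phi> j) (\<phi> k) = t k * x j" if "j \<in> K" "k \<in> K" for j k
  proof -
    have "(\<Sum>j\<in>K. ((if j = k then c else 0) - form (\<phi> j) (\<phi> k)) *s \<phi> j)
        = (\<Sum>j\<in>K. (if j = k then c *s \<phi> j else 0) - form (\<phi> j) (\<phi> k) *s \<phi> j)"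
      by (rule sum.cong) (auto simp: scale_left_diff_distrib)
    also have "\<dots> = c *s \<phi> k - c *s \<phi> k"
      using fin that(2) tight[of "\<phi> k"] by (simp add: sum_subtractf span_base)
    finally have "(\<Sum>j\<in>K. ((if j = k then c else 0) - form (\<phi> j) (\<phi> k)) *s \<phi> j) = 0" by simp
    from ker[OF this] that show ?thesis by (simp add: t_def)
  qed
  have tx: "t k * x k = c - a" if "k \<in> K" for k
    using rank1[OF that that] diag[OF that] by simp
  have G: "form (\<phi> j) (\<phi> k) = - (t k * x j)" if "j \<in> K" "k \<in> K" "j \<noteq> k" for j k
    using rank1[OF that(1,2)] that(3) by (simp add: eq_neg_iff_add_eq_0 minus_equation_iff)
  \<comment> \<open>Pairing the relation \<open>x\<close> with \<open>\<phi> m\<close> yields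
    \<open>c = (s + 1) * (c - a)\<close>, so \<open>a = s * r\<close> with
    \<open>r = c - a\<close>.\<close>
  have "c = (\<Sum>k\<in>K. x k * (if m = k then c else 0))"
    using fin m by (simp add: if_distrib cong: if_cong)
  also have "\<dots> = (\<Sum>k\<in>K. x k * ((if m = k then c else 0) - form (\<phi> m) (\<phi> k)))
      + form (\<phi> m) (\<Sum>k\<in>K. x k *s \<phi> k)"
    unfolding form_sum_scale_right sum.distrib[symmetric] by (simp add: algebra_simps)
  also have "\<dots> = (\<Sum>k\<in>K. c - a)"
    unfolding x0 using rank1[OF m(1)] m tx by (simp add: mult.commute)
  finally have c: "c = of_nat (s + 1) * (c - a)" using card by simp
  define r where "r = c - a"
  have "a = of_nat s * r"
    using c by (simp add: r_def algebra_simps)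
  then have r: "r = a / of_nat s" using s by simp
  have b: "b = r ^ 2"
  proof -
    have "card (K - {m}) > 0" using card fin m s by simp
    then obtain k where k: "k \<in> K" "k \<noteq> m" by (metis DiffE card_gt_0_iff ex_in_conv singletonI)
    then have "b = (t m * x m) * (t k * x k)"
      using off[of k m] m by (simp add: G mult_ac)
    then show ?thesis using tx[OF m(1)] tx[OF k(1)] by (simp only: r_def power2_eq_square)
  qed
  show "a ^ 2 = of_nat s ^ 2 * b" using b r s by (simp add: power_divide)
  show "triple_product form (\<phi> j) (\<phi> k) (\<phi> l) = - (a ^ 3 / of_nat s ^ 3)"
    if "j \<in> K" "k \<in> K" "l \<in> K" "j \<noteq> k" "k \<noteq> l" "j \<noteq> l" for j k l
  proof -
    have "triple_product form (\<phi> j) (\<phi> k) (\<phi> l) = - ((t j * x j) * (t k * x k) * (t l * x l))"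
      using that by (simp add: triple_product_def G)
    also have "\<dots> = - (r ^ 3)" using tx that by (simp add: r_def power3_eq_cube)
    finally show ?thesis by (simp add: r power_divide)
  qed
  \<comment> \<open>Otherwise \<open>b\<close> and the whole Gram matrix vanish, and nondegeneracy
    makes the span zero although its dimension is \<open>s > 0\<close>.\<close>
  show "a \<noteq> 0"
  proof
    assume "a = 0"
    then have "b = 0" using b r by simp
    have G0: "form (\<phi> j) (\<phi> k) = 0" if "j \<in> K" "k \<in> K" for j k
      using off[OF that] diag[OF that(1)] \<open>a = 0\<close> \<open>b = 0\<close> form_eq_0_commute[of "\<phi> j" "\<phi> k"]
      by (cases "j = k") auto
    have "\<phi> k = 0" if "k \<in> K" for k
      by (rule nondegenerate_span_eq_0[OF nondeg]) (use that G0 in \<open>auto intro: span_base\<close>)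
    then have "\<phi> ` K \<subseteq> {0}" by auto
    then have "?U \<subseteq> span {}" using span_mono[of _ "{0}"] by simp
    then have "dim ?U = 0" using dim_le_card[of ?U "{}"] by simp
    then show False using dim s by simp
  qed
qed

section \<open>Triple products and the vector \<open>w\<close>\<close>

text \<open>Multiplying \<open>\<Delta>(\<phi>\<^sub>j, \<phi>\<^sub>k, \<phi>\<^sub>l) = -r\<^sup>3\<close> by \<open>\<langle>\<phi>\<^sub>j, \<phi>\<^sub>l\<rangle>\<close> and cancelling \<open>\<langle>\<phi>\<^sub>l, \<phi>\<^sub>j\<rangle> \<langle>\<phi>\<^sub>j, \<phi>\<^sub>l\<rangle> = r\<^sup>2\<close>
  turns a statement about triangles into one about pairs.\<close>

lemma simplex_vector_relation:
  assumes r: "r \<noteq> 0" and l: "l \<in> K"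
    and pair: "\<And>j k. j \<in> K \<Longrightarrow> k \<in> K \<Longrightarrow> j \<noteq> k \<Longrightarrow> form (\<phi> j) (\<phi> k) * form (\<phi> k) (\<phi> j) = r ^ 2"
    and triple: "\<And>j k l. j \<in> K \<Longrightarrow> k \<in> K \<Longrightarrow> l \<in> K \<Longrightarrow> j \<noteq> k \<Longrightarrow> k \<noteq> l \<Longrightarrow> j \<noteq> l \<Longrightarrow>
      triple_product form (\<phi> j) (\<phi> k) (\<phi> l) = - (r ^ 3)"
    and x: "\<And>j. x j = (if j = l then 1 else - (form (\<phi> j) (\<phi> l) / r))"
    and jk: "j \<in> K" "k \<in> K" "j \<noteq> k"
  shows "form (\<phi> j) (\<phi> k) * x k = - r * x j"
proof -
  consider "k = l" | "j = l" "k \<noteq> l" | "j \<noteq> l" "k \<noteq> l" by blast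
  then show ?thesis
  proof cases
    case 1
    then show ?thesis using jk r by (simp add: x)
  next
    case 2
    then show ?thesis using jk r pair[OF jk] by (simp add: x power2_eq_square)
  next
    case 3
    have "(form (\<phi> j) (\<phi> k) * form (\<phi> k) (\<phi> l)) * r ^ 2
        = triple_product form (\<phi> j) (\<phi> k) (\<phi> l) * form (\<phi> j) (\<phi> l)"
      using pair[OF jk(1) l] 3 by (simp add: triple_product_def flip: pair[OF jk(1) l])
    also have "\<dots> = (- r * form (\<phi> j) (\<phi> l)) * r ^ 2"
      using triple[OF jk(1,2) l jk(3)] 3 by (simp add: power2_eq_square power3_eq_cube)
    finally have "form (\<phi> j) (\<phi> k) * form (\<phi> k) (\<phi> l) = - r * form (\<phi> j) (\<phi> l)"
      using r by (simp only: mult_cancel_right) simp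
    then show ?thesis using 3 r by (simp add: x)
  qed
qed

text \<open>For \<open>j \<noteq> l\<close> the triple product is
  \<open>- r * form (\<phi> l) u\<close> times the \<open>j\<close>-th term of
  \<open>form u w\<close>. At \<open>j = l\<close> it is \<open>s * r * b\<close> instead of
  \<open>- r * b\<close>, which leaves the constant.\<close>

lemma sum_triple_product:
  assumes "finite K" "l \<in> K" "r \<noteq> 0" "form (\<phi> l) (\<phi> l) = of_nat s * r"
    and b: "form (\<phi> l) u * form u (\<phi> l) = b"
    and x: "\<And>j. x j = (if j = l then 1 else - (form (\<phi> j) (\<phi> l) / r))"
  shows "(\<Sum>j\<in>K. triple_product form (\<phi> l) u (\<phi> j)) =
    of_nat (s + 1) * r * b - r * form (\<phi> l) u * form u (\<Sum>j\<in>K. x j *s \<phi> j)"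
proof -
  have "triple_product form (\<phi> l) u (\<phi> j) =
      (if j = l then of_nat (s + 1) * r * b else 0) - r * form (\<phi> l) u * (x j * form u (\<phi> j))" for j
    using assms(3,4) by (auto simp: triple_product_def x b[symmetric] algebra_simps)
  then show ?thesis
    using assms(1,2) by (simp add: form_sum_scale_right sum_subtractf sum_distrib_left)
qed

end

section \<open>The two directions of the equivalence\<close>

theorem theorem6p7:
  fixes scale :: "'f::{field,finite} \<Rightarrow> 'v::ab_group_add \<Rightarrow> 'v"
    and q :: nat and \<sigma> :: "'f \<Rightarrow> 'f" and form :: "'v \<Rightarrow> 'v \<Rightarrow> 'f"
    and s d n :: nat and a b c :: 'f and \<phi> :: "nat \<Rightarrow> 'v" and \<kappa> :: "nat set"
  assumes "nonisotropic_space scale q \<sigma> form"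
    and "s > 1"
    and "vector_space.dim scale (UNIV :: 'v set) = d"
    and "equiangular_tight_frame scale form a b c UNIV {1..n} \<phi>"
    and "d < n"
    and "\<not> CHAR('f) dvd s * (s + 1)"
    and "\<kappa> \<subseteq> {1..n}" and "card \<kappa> = s + 1"
  shows "regular_simplex scale form a b s \<kappa> \<phi> \<longleftrightarrow>
    a ^ 2 = of_nat s ^ 2 * b \<and>
    (\<forall>j\<in>\<kappa>. \<forall>k\<in>\<kappa>. \<forall>l\<in>\<kappa>. j \<noteq> k \<and> k \<noteq> l \<and> j \<noteq> l \<longrightarrow>
       triple_product form (\<phi> j) (\<phi> k) (\<phi> l) = - (a ^ 3 / of_nat s ^ 3) \<and>
       - (a ^ 3 / of_nat s ^ 3) \<noteq> 0) \<and>
    (\<exists>l\<in>\<kappa>. \<forall>k\<in>{1..n} - \<kappa>.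
       (\<Sum>j\<in>\<kappa>. triple_product form (\<phi> l) (\<phi> k) (\<phi> j)) = of_nat (s + 1) / of_nat s * a * b)"
    (is "?simplex \<longleftrightarrow> ?sq \<and> ?triple \<and> (\<exists>l\<in>\<kappa>. ?sum l)")
proof -
  interpret nonisotropic_space scale q \<sigma> form by fact
  have "of_nat (s * (s + 1)) \<noteq> (0 :: 'f)"
    using assms(6) by (simp only: of_nat_eq_0_iff_char_dvd not_False_eq_True)
  then have s0: "of_nat s \<noteq> (0 :: 'f)" and s1: "of_nat (s + 1) \<noteq> (0 :: 'f)"
    by (auto simp only: of_nat_mult mult_eq_0_iff)
  have fin: "finite \<kappa>" using assms(7) finite_subset by blast
  have frame: "span (\<phi> ` {1..n}) = UNIV" "nondegenerate_on (span (\<phi> ` {1..n})) form"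
    and diag: "\<And>j. j \<in> {1..n} \<Longrightarrow> form (\<phi> j) (\<phi> j) = a"
    and pair: "\<And>j k. j \<in> {1..n} \<Longrightarrow> k \<in> {1..n} \<Longrightarrow> j \<noteq> k \<Longrightarrow> form (\<phi> j) (\<phi> k) * form (\<phi> k) (\<phi> j) = b"
    using assms(4)
    by (simp_all add: equiangular_tight_frame_def tight_frame_def nonisotropic_subspace_def)
  note sub = subsetD[OF assms(7)]
  define r where "r = a / of_nat s"
  have a: "a = of_nat s * r" using s0 by (simp add: r_def)
  define x where "x l j = (if j = l then 1 else - (form (\<phi> j) (\<phi> l) / r))" for l j
  define w where "w l = (\<Sum>j\<in>\<kappa>. scale (x l j) (\<phi> j))" for l
  have rel: "form (\<phi> j) (\<phi> k) * x l k = - r * x l j" and b: "b = r ^ 2" and x0: "x l j \<noteq> 0"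
    if "?sq" "?triple" "a \<noteq> 0" "l \<in> \<kappa>" "j \<in> \<kappa>" "k \<in> \<kappa>" "j \<noteq> k" for l j k
  proof -
    show b: "b = r ^ 2" using \<open>?sq\<close> s0 by (simp add: r_def power_divide)
    have r0: "r \<noteq> 0" using \<open>a \<noteq> 0\<close> s0 by (simp add: r_def)
    show "x l j \<noteq> 0"
      using pair[OF sub sub, of j l] that b r0 by (auto simp: x_def)
    have "\<And>j k l. j \<in> \<kappa> \<Longrightarrow> k \<in> \<kappa> \<Longrightarrow> l \<in> \<kappa> \<Longrightarrow> j \<noteq> k \<Longrightarrow> k \<noteq> l \<Longrightarrow> j \<noteq> l \<Longrightarrow>
      triple_product form (\<phi> j) (\<phi> k) (\<phi> l) = - (r ^ 3)"
      using \<open>?triple\<close> by (simp add: r_def power_divide)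
    then show "form (\<phi> j) (\<phi> k) * x l k = - r * x l j"
      by (intro simplex_vector_relation[OF r0 \<open>l \<in> \<kappa>\<close>])
        (use pair[OF sub sub] b that x_def in simp_all)
  qed
  have orth: "form (\<phi> j) (w l) = 0" if "?sq" "?triple" "a \<noteq> 0" "l \<in> \<kappa>" "j \<in> \<kappa>" for l j
    unfolding w_def
    by (rule simplex_vector_orthogonal[OF fin assms(8) \<open>j \<in> \<kappa>\<close>, where r = r])
      (use that rel diag[OF sub] a in simp_all)
  have sum_iff: "(\<Sum>j\<in>\<kappa>. triple_product form (\<phi> l) (\<phi> k) (\<phi> j)) = of_nat (s + 1) / of_nat s * a * b
      \<longleftrightarrow> form (\<phi> k) (w l) = 0"
    if "b \<noteq> 0" "r \<noteq> 0" "l \<in> \<kappa>" "k \<in> {1..n} - \<kappa>" for l k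
  proof -
    have lk: "form (\<phi> l) (\<phi> k) * form (\<phi> k) (\<phi> l) = b"
      by (rule pair) (use that sub in auto)
    have "form (\<phi> l) (\<phi> l) = of_nat s * r" using diag[OF sub] that a by simp
    then have "(\<Sum>j\<in>\<kappa>. triple_product form (\<phi> l) (\<phi> k) (\<phi> j)) =
        of_nat (s + 1) * r * b - r * form (\<phi> l) (\<phi> k) * form (\<phi> k) (w l)"
      unfolding w_def using that lk by (intro sum_triple_product fin) (simp_all add: x_def)
    moreover have "of_nat (s + 1) * r * b = of_nat (s + 1) / of_nat s * a * b"
      by (simp add: r_def)
    \<comment> \<open>Since \<open>b \<noteq> 0\<close>, the factor
      \<open>form (\<phi> l) (\<phi> k)\<close> is nonzero and cancels.\<close>
    ultimately show ?thesis using lk that by auto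
  qed
  show ?thesis
  proof
    assume simplex: ?simplex
    note P = regular_simplex_products[OF simplex _ s0]
    have a0: "a \<noteq> 0" and sq: ?sq using P assms(2) by auto
    have triple: ?triple using P(3) assms(2) a0 s0 by auto
    have r0: "r \<noteq> 0" and b0: "b \<noteq> 0" using a0 s0 sq by (auto simp: r_def)
    obtain l where l: "l \<in> \<kappa>" using assms(8) by fastforce
    have "w l \<in> span (\<phi> ` \<kappa>)"
      unfolding w_def by (intro span_sum span_scale span_base) auto
    \<comment> \<open>Here the span of the simplex is nondegenerate by assumption, so orthogonality
      to its own vectors suffices.\<close>
    then have "w l = 0"
      using simplex orth[OF sq triple a0 l]
      by (intro nondegenerate_span_eq_0[of "\<phi> ` \<kappa>"])
        (auto simp: regular_simplex_def nonisotropic_subspace_def)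
    then have "?sum l" using sum_iff[OF b0 r0 l] by simp
    then show "?sq \<and> ?triple \<and> (\<exists>l\<in>\<kappa>. ?sum l)" using sq triple l by blast
  next
    assume "?sq \<and> ?triple \<and> (\<exists>l\<in>\<kappa>. ?sum l)"
    then obtain l where sq: ?sq and triple: ?triple and l: "l \<in> \<kappa>" and sum: "?sum l" by blast
    \<comment> \<open>The condition \<open>a ^ 3 / s ^ 3 \<noteq> 0\<close> is stated only for
      distinct triples; \<open>s > 1\<close> provides one.\<close>
    obtain T where "T \<subseteq> \<kappa>" "card T = 3"
      using obtain_subset_with_card_n[of 3 \<kappa>] assms(2,8) by auto
    then obtain i j k where ijk: "i \<in> \<kappa>" "j \<in> \<kappa>" "k \<in> \<kappa>" "i \<noteq> j" "j \<noteq> k" "i \<noteq> k"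
      by (auto simp: card_3_iff)
    then have "- (a ^ 3 / of_nat s ^ 3) \<noteq> 0" using triple by blast
    then have a0: "a \<noteq> 0" by auto
    have r0: "r \<noteq> 0" and b0: "b \<noteq> 0" using a0 s0 sq by (auto simp: r_def)
    \<comment> \<open>Nondegeneracy of the span of \<kappa> is not yet known, so \<open>w l\<close>
      is tested against the whole frame: \<open>orth\<close> covers \<kappa>, the sum condition the
      rest.\<close>
    have "form (\<phi> k) (w l) = 0" if "k \<in> {1..n}" for k
      using orth[OF sq triple a0 l, of k] sum sum_iff[OF b0 r0 l, of k] that by blast
    then have w0: "w l = 0"
      by (intro nondegenerate_span_eq_0[OF frame(2)]) (use frame(1) in auto)
    have "b = r ^ 2" using b[OF sq triple a0 l] ijk by blast
    moreover have "regular_simplex scale form (of_nat s * r) (r ^ 2) s \<kappa> \<phi>"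
    proof (rule regular_simplexI[OF fin assms(8) l, where x = "x l"])
      show "x l j \<noteq> 0" if "j \<in> \<kappa>" for j
        \<comment> \<open>\<open>x0\<close> wants a second index different from \<open>j\<close>;
          the triple supplies one.\<close>
        using x0[OF sq triple a0 l that] ijk by metis
    qed (use s1 r0 w0 diag[OF sub] a rel[OF sq triple a0 l] in \<open>auto simp: w_def simp del: of_nat_add\<close>)
    ultimately show ?simplex using a by simp
  qed
qed

end
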